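(* Let $CO$ be the Copeland social choice correspondence. (1) If $|A|=3$ and $|I|$ is odd, then $CO$ is $\mathbf{K}$-strategy-proof. (2) If $|A|=3$ and $|I|$ is even, then $CO$ is $\Omega^{CO}$-$\mathbf{K}$-manipulable. (3) If $|A|\ge 4$, then $CO$ is $\Omega^{CO}$-$\mathbf{K}$-manipulable.
   Context: Standing setting: $A$ (alternatives) and $I$ (individuals) are finite sets with $|A|\ge 2$, $|I|\ge 2$. $P_0(X)$ is the set of nonempty subsets of $X$. For a relation $R$ on a set $X$, $x\succeq_R y$ means $(x,y)\in R$, and $x\succ_R y$ means $(x,y)\in R$ and $(y,x)\notin R$. $\mathcal{L}(A)$ is the set of linear orders (complete, transitive, antisymmetric relations) on $A$. For $J\subseteq I$, $\mathcal{L}(A)^J$ is the set of functions $J\to\mathcal{L}(A)$. For $i\in I$, $\overline{p}\in\mathcal{L}(A)^{I\setminus\{i\}}$, $q\in\mathcal{L}(A)$, $(\overline{p},q[i])\in\mathcal{L}(A)^I$ is the profile equal to $q$ at $i$ and to $\overline{p}(j)$ at every $j\ne i$. A social choice correspondence (scc) is a function $F:\mathcal{L}(A)^I\to P_0(A)$. Copeland: for $p\in\mathcal{L}(A)^I$ and $x,y\in A$ let $c_p(x,y)=|\{i\in I:x\succ_{p(i)}y\}|$, $w_p(x)=|\{y\in A\setminus\{x\}:c_p(x,y)>c_p(y,x)\}|$, $l_p(x)=|\{y\in A\setminus\{x\}:c_p(x,y)<c_p(y,x)\}|$, and $\mathrm{co}(x,p)=w_p(x)-l_p(x)$. Then $CO(p)=\mathrm{argmax}_{x\in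 A}\mathrm{co}(x,p)$ (set of all maximizers). Kelly extension rule: for $q\in\mathcal{L}(A)$, $\mathbf{K}(q)$ is the relation on $P_0(A)$ given by $(B,C)\in\mathbf{K}(q)$ iff $B=C$ or $x\succeq_q y$ for all $x\in B$, $y\in C$. A scc $F$ is $\mathbf{K}$-manipulable if there exist $i\in I$, $q,q'\in\mathcal{L}(A)$ and $\overline{p}\in\mathcal{L}(A)^{I\setminus\{i\}}$ with $F(\overline{p},q'[i])\succ_{\mathbf{K}(q)}F(\overline{p},q[i])$; it is $\mathbf{K}$-strategy-proof if it is not $\mathbf{K}$-manipulable. Winner information: for a scc $F$, $i\in I$, $q\in\mathcal{L}(A)$, $\Omega^F_i(q)=\big\{\{\overline{p}\in\mathcal{L}(A)^{I\setminus\{i\}}:F(\overline{p},q[i])=X\}: X\in\mathrm{Im}(F)\big\}\setminus\{\varnothing\}$. A scc $F$ is $\Omega^F$-$\mathbf{K}$-manipulable if there exist $i\in I$, $q,q'\in\mathcal{L}(A)$ and $\omega\in\Omega^F_i(q)$ such that $F(\overline{p}',q'[i])\succ_{\mathbf{K}(q)}F(\overline{p}',q[i])$ for some $\overline{p}'\in\omega$, and $F(\overline{p},q'[i])\succeq_{\mathbf{K}(q)}F(\overline{p},q[i])$ for every $\overline{p}\in\omega$. *)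

theory Defs
  imports Main "HOL-Library.FuncSet"
begin

text \<open>
  Alternatives form a set \<open>A\<close> and individuals a set \<open>I\<close>. A preference relation contains \<open>(x, y)\<close>
  when \<open>x\<close> is at least as good as \<open>y\<close>, so the greater element comes first, contrary to the
  usual reading of orders in the library.
\<close>

definition weakly_pref :: "'x rel \<Rightarrow> 'x \<Rightarrow> 'x \<Rightarrow> bool" where
  "weakly_pref R x y \<longleftrightarrow> (x, y) \<in> R"

definition strictly_pref :: "'x rel \<Rightarrow> 'x \<Rightarrow> 'x \<Rightarrow> bool" where
  "strictly_pref R x y \<longleftrightarrow> (x, y) \<in> R \<and> (y, x) \<notin> R"

definition nonempty_subsets :: "'x set \<Rightarrow> 'x set set" where
  "nonempty_subsets X = Pow X - {{}}"

definition linear_orders :: "'a set \<Rightarrow> 'a rel set" where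
  "linear_orders A = {r. linear_order_on A r}"

text \<open>
  Functions from \<open>J\<close> to the linear orders are extensional, hence uniquely determined by their
  values on \<open>J\<close>. In particular, for \<open>p\<close> in \<open>profiles A (I - {i})\<close> the profile that equals \<open>q\<close> at
  \<open>i\<close> and \<open>p j\<close> at every other \<open>j\<close> is the function update \<open>p(i := q)\<close>.
\<close>

definition profiles :: "'a set \<Rightarrow> 'i set \<Rightarrow> ('i \<Rightarrow> 'a rel) set" where
  "profiles A J = (J \<rightarrow>\<^sub>E linear_orders A)"

definition social_choice_correspondence ::
    "'a set \<Rightarrow> 'i set \<Rightarrow> (('i \<Rightarrow> 'a rel) \<Rightarrow> 'a set) \<Rightarrow> bool" where
  "social_choice_correspondence A I F \<longleftrightarrow> F \<in> profiles A I \<rightarrow> nonempty_subsets A"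

definition pref_count :: "'i set \<Rightarrow> ('i \<Rightarrow> 'a rel) \<Rightarrow> 'a \<Rightarrow> 'a \<Rightarrow> nat" where
  "pref_count I p x y = card {i \<in> I. strictly_pref (p i) x y}"

definition wins :: "'a set \<Rightarrow> 'i set \<Rightarrow> ('i \<Rightarrow> 'a rel) \<Rightarrow> 'a \<Rightarrow> nat" where
  "wins A I p x = card {y \<in> A - {x}. pref_count I p x y > pref_count I p y x}"

definition losses :: "'a set \<Rightarrow> 'i set \<Rightarrow> ('i \<Rightarrow> 'a rel) \<Rightarrow> 'a \<Rightarrow> nat" where
  "losses A I p x = card {y \<in> A - {x}. pref_count I p x y < pref_count I p y x}"

definition copeland_score :: "'a set \<Rightarrow> 'i set \<Rightarrow> 'a \<Rightarrow> ('i \<Rightarrow> 'a rel) \<Rightarrow> int" where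
  "copeland_score A I x p = int (wins A I p x) - int (losses A I p x)"

definition copeland :: "'a set \<Rightarrow> 'i set \<Rightarrow> ('i \<Rightarrow> 'a rel) \<Rightarrow> 'a set" where
  "copeland A I p = {x. is_arg_max (\<lambda>y. copeland_score A I y p) (\<lambda>y. y \<in> A) x}"

definition kelly :: "'a set \<Rightarrow> 'a rel \<Rightarrow> 'a set rel" where
  "kelly A q = {(B, C). B \<in> nonempty_subsets A \<and> C \<in> nonempty_subsets A \<and>
     (B = C \<or> (\<forall>x\<in>B. \<forall>y\<in>C. weakly_pref q x y))}"

text \<open>In the following, \<open>E\<close> is an extension rule, such as \<open>kelly A\<close>.\<close>

definition manipulable ::
    "'a set \<Rightarrow> 'i set \<Rightarrow> ('a rel \<Rightarrow> 'a set rel) \<Rightarrow> (('i \<Rightarrow> 'a rel) \<Rightarrow> 'a set) \<Rightarrow> bool" where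
  "manipulable A I E F \<longleftrightarrow>
     (\<exists>i\<in>I. \<exists>q\<in>linear_orders A. \<exists>q'\<in>linear_orders A. \<exists>p\<in>profiles A (I - {i}).
        strictly_pref (E q) (F (p(i := q'))) (F (p(i := q))))"

definition strategy_proof ::
    "'a set \<Rightarrow> 'i set \<Rightarrow> ('a rel \<Rightarrow> 'a set rel) \<Rightarrow> (('i \<Rightarrow> 'a rel) \<Rightarrow> 'a set) \<Rightarrow> bool" where
  "strategy_proof A I E F \<longleftrightarrow> \<not> manipulable A I E F"

definition winner_info ::
    "'a set \<Rightarrow> 'i set \<Rightarrow> (('i \<Rightarrow> 'a rel) \<Rightarrow> 'a set) \<Rightarrow> 'i \<Rightarrow> 'a rel \<Rightarrow> ('i \<Rightarrow> 'a rel) set set" where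
  "winner_info A I F i q =
     {{p \<in> profiles A (I - {i}). F (p(i := q)) = X} | X. X \<in> F ` profiles A I} - {{}}"

definition winner_info_manipulable ::
    "'a set \<Rightarrow> 'i set \<Rightarrow> ('a rel \<Rightarrow> 'a set rel) \<Rightarrow> (('i \<Rightarrow> 'a rel) \<Rightarrow> 'a set) \<Rightarrow> bool" where
  "winner_info_manipulable A I E F \<longleftrightarrow>
     (\<exists>i\<in>I. \<exists>q\<in>linear_orders A. \<exists>q'\<in>linear_orders A. \<exists>\<omega>\<in>winner_info A I F i q.
        (\<exists>p\<in>\<omega>. strictly_pref (E q) (F (p(i := q'))) (F (p(i := q)))) \<and>
        (\<forall>p\<in>\<omega>. weakly_pref (E q) (F (p(i := q'))) (F (p(i := q)))))"

lemma profiles_fun_upd: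
  assumes "i \<in> I" "p \<in> profiles A (I - {i})" "q \<in> linear_orders A"
  shows "p(i := q) \<in> profiles A I"
  using assms by (auto simp: profiles_def PiE_iff extensional_def)

lemma copeland_scc:
  assumes "finite A" "A \<noteq> {}"
  shows "social_choice_correspondence A I (copeland A I)"
proof -
  have "copeland A I p \<in> nonempty_subsets A" for p
  proof -
    let ?S = "(\<lambda>y. copeland_score A I y p) ` A"
    have "Max ?S \<in> ?S"
      using assms by (intro Max_in) auto
    then obtain x where "x \<in> A" "copeland_score A I x p = Max ?S"
      by auto
    moreover have "copeland_score A I y p \<le> Max ?S" if "y \<in> A" for y
      using assms that by (intro Max_ge) auto
    ultimately have "x \<in> copeland A I p"
      by (fastforce simp: copeland_def is_arg_max_linorder)
    then show ?thesis
      by (auto simp: nonempty_subsets_def copeland_def is_arg_max_def)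
  qed
  then show ?thesis
    by (auto simp: social_choice_correspondence_def)
qed

end

theory Submission
  imports Defs
begin

text \<open>
  The Copeland score of \<open>x\<close> is the sum of the signs of its majority margins. With three
  alternatives and an odd number of voters there are no majority ties, so either some alternative
  beats all others and wins alone, or all three win; misreporting can only hurt the alternatives that
  the manipulator prefers in each relevant duel.

  With at least four alternatives, let the voter's true order have \<open>s\<close> directly above \<open>x\<close>, where
  \<open>x\<close> is the voter's favourite among several winners. Exchanging \<open>s\<close> and \<open>x\<close> affects a single duel,
  so it either changes nothing or makes \<open>x\<close> the unique winner: the manipulation is safe for every
  profile with these winners. With three alternatives and an even number of voters, the
  voter instead lowers the less preferred one of two winners.
\<close>

section \<open>Majority margins\<close>

text \<open>Signed votes make opposite orders cancel: reversing an order negates its vote, and a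
  linear order contributes 1 or -1 to each duel of distinct alternatives.\<close>

definition vote :: "'a rel \<Rightarrow> 'a \<Rightarrow> 'a \<Rightarrow> int" where
  "vote R x y = of_bool (strictly_pref R x y) - of_bool (strictly_pref R y x)"

definition margin :: "'i set \<Rightarrow> ('i \<Rightarrow> 'a rel) \<Rightarrow> 'a \<Rightarrow> 'a \<Rightarrow> int" where
  "margin I p x y = (\<Sum>i\<in>I. vote (p i) x y)"

lemma vote_same [simp]: "vote R x x = 0"
  by (simp add: vote_def)

lemma vote_swap: "vote R y x = - vote R x y"
  by (simp add: vote_def)

lemma vote_converse: "vote (R\<inverse>) x y = - vote R x y"
  by (simp add: vote_def strictly_pref_def)

lemma linear_order_on_antisym:
  "linear_order_on A q \<Longrightarrow> (x, y) \<in> q \<Longrightarrow> (y, x) \<in> q \<Longrightarrow> x = y"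
  by (auto simp: linear_order_on_def partial_order_on_def dest: antisymD)

lemma linear_order_on_total:
  "linear_order_on A q \<Longrightarrow> x \<in> A \<Longrightarrow> y \<in> A \<Longrightarrow> x \<noteq> y \<Longrightarrow> (x, y) \<notin> q \<Longrightarrow> (y, x) \<in> q"
  by (auto simp: linear_order_on_def total_on_def)

lemma vote_linear_order:
  assumes "q \<in> linear_orders A" "x \<in> A" "y \<in> A" "x \<noteq> y"
  shows "vote q x y = (if (x, y) \<in> q then 1 else - 1)"
  using assms linear_order_on_antisym[of A q x y] linear_order_on_total[of A q x y]
  by (auto simp: vote_def strictly_pref_def linear_orders_def)

lemma margin_same [simp]: "margin I p x x = 0"
  by (simp add: margin_def)

lemma margin_swap: "margin I p y x = - margin I p x y"
  by (simp add: margin_def vote_swap[of _ y x] sum_negf)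

lemma margin_pref_count:
  "finite I \<Longrightarrow> margin I p x y = int (pref_count I p x y) - int (pref_count I p y x)"
  by (simp add: margin_def vote_def pref_count_def sum_subtractf sum.If_cases of_bool_def
      Int_def)

lemma margin_fun_upd:
  assumes "finite I" "i \<in> I"
  shows "margin I (p(i := q)) x y = vote q x y + margin (I - {i}) p x y"
proof -
  have "margin I (p(i := q)) x y =
      vote q x y + (\<Sum>j\<in>I - {i}. vote ((p(i := q)) j) x y)"
    unfolding margin_def using assms by (subst sum.remove[of I i]) auto
  also have "(\<Sum>j\<in>I - {i}. vote ((p(i := q)) j) x y) = margin (I - {i}) p x y"
    unfolding margin_def by (rule sum.cong) auto
  finally show ?thesis .
qed

text \<open>Each voter contributes the odd number 1 or -1, so the parity of the sum is that of the
  number of voters.\<close>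

lemma even_margin_iff:
  assumes "finite I" "p \<in> profiles A I" "x \<in> A" "y \<in> A" "x \<noteq> y"
  shows "even (margin I p x y) \<longleftrightarrow> even (card I)"
proof -
  have "odd (vote (p i) x y)" if "i \<in> I" for i
    using assms that by (subst vote_linear_order[of _ A]) (auto simp: profiles_def)
  then show ?thesis
    using \<open>finite I\<close> by (auto simp: margin_def even_sum_iff intro!: arg_cong[of _ _ "\<lambda>J. even (card J)"])
qed

text \<open>In this form a change in a single duel changes a single summand. The duel of
  \<open>x\<close> with itself may be included because its margin is 0.\<close>

lemma copeland_score_margin:
  assumes "finite A" "finite I"
  shows "copeland_score A I x p = (\<Sum>y\<in>A. sgn (margin I p x y))"
proof -
  have "(\<Sum>y\<in>A. sgn (margin I p x y)) =
      (\<Sum>y\<in>A. of_bool (margin I p x y > 0) - of_bool (margin I p x y < 0))"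
    by (rule sum.cong) (auto simp: sgn_if)
  also have "\<dots> = int (card {y \<in> A. margin I p x y > 0}) - int (card {y \<in> A. margin I p x y < 0})"
    using assms by (simp add: sum_subtractf of_bool_def sum.If_cases Int_def)
  also have "{y \<in> A. margin I p x y > 0} = {y \<in> A - {x}. pref_count I p x y > pref_count I p y x}"
    using assms by (auto simp: margin_pref_count)
  also have "{y \<in> A. margin I p x y < 0} = {y \<in> A - {x}. pref_count I p x y < pref_count I p y x}"
    using assms by (auto simp: margin_pref_count)
  finally show ?thesis
    by (simp add: copeland_score_def wins_def losses_def)
qed

lemma in_copeland_iff:
  "x \<in> copeland A I p \<longleftrightarrow> x \<in> A \<and> (\<forall>y\<in>A. copeland_score A I y p \<le> copeland_score A I x p)"
  by (auto simp: copeland_def is_arg_max_linorder)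

lemma copeland_nonempty_subset:
  assumes "finite A" "A \<noteq> {}" "p \<in> profiles A I"
  shows "copeland A I p \<in> nonempty_subsets A"
  using copeland_scc[of A I] assms by (auto simp: social_choice_correspondence_def)

text \<open>The information set is given by one of its members: it is the set of all profiles with
  the same winners as \<open>p\<close>, and \<open>p\<close> itself shows that it is
  nonempty.\<close>

lemma winner_info_manipulableI:
  assumes i: "i \<in> I" "q \<in> linear_orders A" "q' \<in> linear_orders A"
    and p: "p \<in> profiles A (I - {i})"
    and weak: "\<And>p'. p' \<in> profiles A (I - {i}) \<Longrightarrow> F (p'(i := q)) = F (p(i := q)) \<Longrightarrow>
      weakly_pref (E q) (F (p'(i := q'))) (F (p'(i := q)))"
    and strict: "strictly_pref (E q) (F (p(i := q'))) (F (p(i := q)))"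
  shows "winner_info_manipulable A I E F"
proof -
  let ?w = "{p' \<in> profiles A (I - {i}). F (p'(i := q)) = F (p(i := q))}"
  have "?w \<in> winner_info A I F i q"
    using p profiles_fun_upd[OF i(1) p i(2)] by (auto simp: winner_info_def)
  then show ?thesis
    unfolding winner_info_manipulable_def using i p weak strict
    by (intro bexI[of _ i] bexI[of _ q] bexI[of _ q'] bexI[of _ ?w]) auto
qed

section \<open>Profiles with prescribed margins\<close>

definition rank_order :: "'a set \<Rightarrow> ('a \<Rightarrow> nat) \<Rightarrow> 'a rel" where
  "rank_order A f = {(x, y). x \<in> A \<and> y \<in> A \<and> f x \<le> f y}"

lemma rank_order_linear: "inj_on f A \<Longrightarrow> rank_order A f \<in> linear_orders A"
  by (auto simp: linear_orders_def rank_order_def linear_order_on_def partial_order_on_def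
      preorder_on_def refl_on_def total_on_def intro!: transI antisymI dest: inj_onD)

lemma vote_rank_order:
  "x \<in> A \<Longrightarrow> y \<in> A \<Longrightarrow> vote (rank_order A f) x y = sgn (int (f y) - int (f x))"
  by (auto simp: vote_def strictly_pref_def rank_order_def sgn_if)

lemma converse_in_linear_orders: "q \<in> linear_orders A \<Longrightarrow> q\<inverse> \<in> linear_orders A"
  by (simp add: linear_orders_def)

text \<open>The remaining voters are paired off, the two members of each pair having opposite orders.\<close>

lemma ex_profile_margin:
  assumes "finite J" "set rs \<subseteq> linear_orders A" "linear_orders A \<noteq> {}"
    and "length rs \<le> card J" "even (card J - length rs)"
  shows "\<exists>p\<in>profiles A J. \<forall>x y. margin J p x y = (\<Sum>r\<leftarrow>rs. vote r x y)"
proof -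
  obtain r0 where r0: "r0 \<in> linear_orders A"
    using assms by auto
  obtain k where k: "card J - length rs = 2 * k"
    using assms(5) by (rule evenE)
  \<comment> \<open>The order \<open>r0\<close> is arbitrary, since it cancels against its converse
    in every duel. The parity assumption lets these pairs use up exactly the voters not covered by
    \<open>rs\<close>.\<close>
  define ps where "ps = rs @ replicate k r0 @ replicate k (r0\<inverse>)"
  have len: "length ps = card J"
    using k assms by (simp add: ps_def)
  have ps: "set ps \<subseteq> linear_orders A"
    using assms r0 converse_in_linear_orders[OF r0] by (auto simp: ps_def set_replicate_conv_if)
  obtain h where h: "bij_betw h J {0..<card J}"
    using ex_bij_betw_finite_nat[OF \<open>finite J\<close>] by auto
  define p where "p = restrict (\<lambda>j. ps ! h j) J"
  show ?thesis
  proof (intro bexI allI)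
    have "ps ! h j \<in> linear_orders A" if "j \<in> J" for j
      using ps len bij_betwE[OF h] that by (metis atLeastLessThan_iff nth_mem subsetD)
    then show "p \<in> profiles A J"
      by (auto simp: p_def profiles_def)
    show "margin J p x y = (\<Sum>r\<leftarrow>rs. vote r x y)" for x y
    proof -
      have "margin J p x y = (\<Sum>j\<in>J. vote (ps ! h j) x y)"
        by (simp add: margin_def p_def)
      also have "\<dots> = (\<Sum>l = 0..<card J. vote (ps ! l) x y)"
        by (rule sum.reindex_bij_betw[OF h])
      also have "\<dots> = (\<Sum>r\<leftarrow>ps. vote r x y)"
        by (simp add: sum_list_sum_nth len)
      also have "\<dots> = (\<Sum>r\<leftarrow>rs. vote r x y)"
        by (simp add: ps_def sum_list_replicate vote_converse)
      finally show ?thesis .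
    qed
  qed
qed

section \<open>Three alternatives\<close>

text \<open>All scores are expressed through the same three margins, which reduces later claims to a
  case split on three signs.\<close>

lemma copeland_score_three:
  assumes "finite I" "distinct [a, b, c]"
  shows "copeland_score {a, b, c} I a p = sgn (margin I p a b) + sgn (margin I p a c)"
    and "copeland_score {a, b, c} I b p = sgn (margin I p b c) - sgn (margin I p a b)"
    and "copeland_score {a, b, c} I c p = - sgn (margin I p a c) - sgn (margin I p b c)"
  using assms margin_swap[of I p b a] margin_swap[of I p c a] margin_swap[of I p c b]
  by (auto simp: copeland_score_margin sgn_minus)

lemma three_elements:
  assumes "card A = 3" "x \<in> A"
  obtains y z where "A = {x, y, z}" "distinct [x, y, z]"
proof -
  have "card (A - {x}) = 2"
    using assms by (simp add: card_Diff_singleton)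
  then obtain y z where "A - {x} = {y, z}" "y \<noteq> z"
    by (auto simp: card_2_iff)
  with assms show ?thesis
    by (intro that[of y z]) auto
qed

text \<open>Two wins give \<open>x\<close> the score 2, while any other alternative loses to
  \<open>x\<close> and so has score at most 0.\<close>

lemma copeland_condorcet_winner_three:
  assumes "finite I" "card A = 3" "x \<in> A"
    and "\<And>y. y \<in> A \<Longrightarrow> y \<noteq> x \<Longrightarrow> margin I p x y > 0"
  shows "copeland A I p = {x}"
proof -
  obtain y z where A: "A = {x, y, z}" and d: "distinct [x, y, z]"
    using three_elements assms by metis
  have "margin I p x y > 0" "margin I p x z > 0"
    using assms(4) A d by auto
  then show ?thesis
    using copeland_score_three[OF \<open>finite I\<close> d, of p] unfolding A
    by (auto simp: in_copeland_iff sgn_if split: if_splits)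
qed

text \<open>An odd number of voters excludes ties. A tournament on three alternatives either has one
  that beats both others or is a cycle, and in a cycle all scores are 0 and everyone wins.\<close>

lemma copeland_three_odd:
  assumes "finite I" "odd (card I)" "card A = 3" "p \<in> profiles A I"
    and "copeland A I p \<noteq> A"
  obtains x where "x \<in> A" "copeland A I p = {x}"
    and "\<And>y. y \<in> A \<Longrightarrow> y \<noteq> x \<Longrightarrow> margin I p x y > 0"
proof -
  obtain a b c where A: "A = {a, b, c}" and d: "distinct [a, b, c]"
    using assms(3) by (auto simp: card_3_iff)
  have "margin I p a b \<noteq> 0" "margin I p a c \<noteq> 0" "margin I p b c \<noteq> 0"
    using even_margin_iff[OF assms(1,4), of a b] even_margin_iff[OF assms(1,4), of a c]
      even_margin_iff[OF assms(1,4), of b c] assms(2) A d by auto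
  moreover note sc = copeland_score_three[OF \<open>finite I\<close> d, of p]
  moreover have "\<not> (copeland_score A I a p = copeland_score A I b p \<and>
      copeland_score A I b p = copeland_score A I c p)"
    using assms(5) A by (auto simp: in_copeland_iff)
  ultimately have "\<exists>x\<in>A. \<forall>y\<in>A. y \<noteq> x \<longrightarrow> margin I p x y > 0"
    using A d margin_swap[of I p b a] margin_swap[of I p c a] margin_swap[of I p c b]
    by (auto simp: sgn_if split: if_splits)
  then obtain x where "x \<in> A" "\<And>y. y \<in> A \<Longrightarrow> y \<noteq> x \<Longrightarrow> margin I p x y > 0"
    by auto
  then show ?thesis
    using copeland_condorcet_winner_three[of I A x p] assms that by metis
qed

text \<open>In a duel whose preferred side is \<open>x\<close>, the true order already contributes
  the largest possible vote, 1.\<close>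

lemma margin_truthful_ge:
  assumes "finite I" "i \<in> I" "q \<in> linear_orders A" "q' \<in> linear_orders A"
    and "x \<in> A" "y \<in> A" "(x, y) \<in> q"
  shows "margin I (p(i := q')) x y \<le> margin I (p(i := q)) x y"
  using assms vote_linear_order[of q A x y] vote_linear_order[of q' A x y]
  by (cases "x = y") (auto simp: margin_fun_upd)

theorem copeland_three_odd_strategy_proof:
  assumes "finite I" "odd (card I)" "card A = 3"
  shows "strategy_proof A I (kelly A) (copeland A I)"
proof -
  have False
    if i: "i \<in> I" and q: "q \<in> linear_orders A" and q': "q' \<in> linear_orders A"
      and p: "p \<in> profiles A (I - {i})"
      and strict: "strictly_pref (kelly A q) (copeland A I (p(i := q'))) (copeland A I (p(i := q)))"
    for i q q' p
  proof -
    let ?X = "copeland A I (p(i := q))" and ?Y = "copeland A I (p(i := q'))"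
    note prof = profiles_fun_upd[OF i p q] profiles_fun_upd[OF i p q']
    note odd = copeland_three_odd[OF assms, OF prof(1)] copeland_three_odd[OF assms, OF prof(2)]
    note ge = margin_truthful_ge[OF assms(1) i q q']
    have ne: "?Y \<noteq> ?X" and sub: "?X \<subseteq> A" "?Y \<subseteq> A" and "?Y \<noteq> {}"
      and better: "\<And>x y. y \<in> ?Y \<Longrightarrow> x \<in> ?X \<Longrightarrow> (y, x) \<in> q"
      using strict by (auto simp: strictly_pref_def kelly_def nonempty_subsets_def weakly_pref_def)
    show False
    proof (cases "?X = A")
      case True
      with ne obtain y where y: "y \<in> A" "?Y = {y}"
        and "\<And>v. v \<in> A \<Longrightarrow> v \<noteq> y \<Longrightarrow> margin I (p(i := q')) y v > 0"
        using odd(2) by metis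
      \<comment> \<open>As every alternative is in \<open>?X\<close>, \<open>y\<close> is the
        manipulator's favourite. Truth only increases its margins, so \<open>y\<close> would have
        won alone already.\<close>
      then have "margin I (p(i := q)) y v > 0" if "v \<in> A" "v \<noteq> y" for v
        using ge[of y v p] better[of y v] True that by force
      then have "?X = {y}"
        using copeland_condorcet_winner_three[of I A y] assms y by auto
      with y ne show False by simp
    next
      case False
      then obtain x where x: "x \<in> A" "?X = {x}"
        and win: "\<And>v. v \<in> A \<Longrightarrow> v \<noteq> x \<Longrightarrow> margin I (p(i := q)) x v > 0"
        using odd(1) by metis
      \<comment> \<open>The manipulator likes every such \<open>v\<close> better than
        \<open>x\<close>, so the false report cannot improve the result of \<open>v\<close> against
        \<open>x\<close>.\<close>
      have still: "margin I (p(i := q')) x v > 0" if "v \<in> ?Y" "v \<noteq> x" for v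
      proof -
        have "v \<in> A" using that sub by auto
        then show ?thesis
          using ge[of v x p] better[of v x] x win[of v] that
            margin_swap[of I "p(i := q)" v x] margin_swap[of I "p(i := q')" v x] by force
      qed
      show False
      proof (cases "?Y = A")
        case True
        then have "?Y = {x}"
          using copeland_condorcet_winner_three[of I A x] assms x still by auto
        with ne x show False by simp
      next
        case False
        then obtain y where y: "y \<in> A" "?Y = {y}"
          and "\<And>v. v \<in> A \<Longrightarrow> v \<noteq> y \<Longrightarrow> margin I (p(i := q')) y v > 0"
          using odd(2) by metis
        with still[of y] ne x margin_swap[of I "p(i := q')" y x] show False
          by force
      qed
    qed
  qed
  then show ?thesis
    by (auto simp: strategy_proof_def manipulable_def)
qed

text \<open>
  A voter with true order \<open>a, b, c\<close> reports \<open>a, c, b\<close> when the winners are \<open>a\<close> and \<open>b\<close>. Then \<open>c\<close>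
  has lost to both by at least two votes, as margins are even, so \<open>c\<close> can at best tie with \<open>b\<close>.
\<close>

theorem copeland_three_even_manipulable:
  assumes fin: "finite I" and ev: "even (card I)" and "card I \<ge> 2" "card A = 3"
  shows "winner_info_manipulable A I (kelly A) (copeland A I)"
proof -
  obtain a b c where A: "A = {a, b, c}" and d: "distinct [a, b, c]"
    using assms(4) by (auto simp: card_3_iff)
  obtain i where i: "i \<in> I"
    using assms(3) by fastforce
  \<comment> \<open>The default value of each function is the position of \<open>c\<close>. The
    order \<open>r\<close> is \<open>b\<close>, \<open>a\<close>, \<open>c\<close>; together with
    \<open>q\<close> it ties \<open>a\<close> with \<open>b\<close> and lets both beat
    \<open>c\<close>.\<close>
  define q where "q = rank_order A ((\<lambda>_. 2)(a := 0, b := 1))"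
  define q' where "q' = rank_order A ((\<lambda>_. 1)(a := 0, b := 2))"
  define r where "r = rank_order A ((\<lambda>_. 2)(b := 0, a := 1))"
  have lin: "q \<in> linear_orders A" "q' \<in> linear_orders A" "r \<in> linear_orders A"
    unfolding q_def q'_def r_def using A d by (auto intro!: rank_order_linear simp: inj_on_def)
  have votes: "vote q a b = 1" "vote q a c = 1" "vote q b c = 1"
    "vote q' a b = 1" "vote q' a c = 1" "vote q' b c = - 1"
    "vote r a b = - 1" "vote r a c = 1" "vote r b c = 1"
    using A d by (auto simp: q_def q'_def r_def vote_rank_order)
  note upd = margin_fun_upd[OF fin i]
  note score = copeland_score_three[OF fin d, folded A]
  have "card (I - {i}) = card I - 1"
    using i by (simp add: card_Diff_singleton)
  then have len: "length [r] \<le> card (I - {i})" "even (card (I - {i}) - length [r])"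
    using ev assms(3) by auto
  have "finite (I - {i})" "set [r] \<subseteq> linear_orders A" "linear_orders A \<noteq> {}"
    using fin lin by auto
  from ex_profile_margin[OF this len] obtain p where p: "p \<in> profiles A (I - {i})"
    and m: "\<And>x y. margin (I - {i}) p x y = (\<Sum>r\<leftarrow>[r]. vote r x y)"
    by blast
  have winners_iff: "x \<in> copeland A I p' \<longleftrightarrow> x \<in> {a, b, c} \<and>
      copeland_score A I a p' \<le> copeland_score A I x p' \<and>
      copeland_score A I b p' \<le> copeland_score A I x p' \<and>
      copeland_score A I c p' \<le> copeland_score A I x p'" for x p'
    unfolding in_copeland_iff A by auto
  have "copeland_score A I a (p(i := q)) = 1" "copeland_score A I b (p(i := q)) = 1"
    "copeland_score A I c (p(i := q)) = - 2"
    unfolding score upd m by (simp_all add: votes)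
  then have X: "copeland A I (p(i := q)) = {a, b}"
    by (auto simp: winners_iff)
  have "copeland_score A I a (p(i := q')) = 1" "copeland_score A I b (p(i := q')) = 0"
    "copeland_score A I c (p(i := q')) = - 1"
    unfolding score upd m by (simp_all add: votes)
  then have Y: "copeland A I (p(i := q')) = {a}"
    by (auto simp: winners_iff)
  have order: "(a, a) \<in> q" "(a, b) \<in> q" "(b, a) \<notin> q"
    using A d by (auto simp: q_def rank_order_def)
  have "a \<in> A" "b \<in> A"
    using A by auto
  then have kelly: "({a}, {a, b}) \<in> kelly A q" "({a, b}, {a, b}) \<in> kelly A q"
    "({a, b}, {a}) \<notin> kelly A q"
    using d order by (auto simp: kelly_def weakly_pref_def nonempty_subsets_def)
  show ?thesis
  proof (rule winner_info_manipulableI[OF i lin(1,2) p])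
    show "strictly_pref (kelly A q) (copeland A I (p(i := q'))) (copeland A I (p(i := q)))"
      unfolding X Y strictly_pref_def using kelly by simp
    fix p'
    assume p': "p' \<in> profiles A (I - {i})"
      and "copeland A I (p'(i := q)) = copeland A I (p(i := q))"
    then have X': "copeland A I (p'(i := q)) = {a, b}"
      using X by simp
    have "a \<in> copeland A I (p'(i := q))" "b \<in> copeland A I (p'(i := q))"
      "c \<notin> copeland A I (p'(i := q))"
      using X' d by auto
    then have sc: "copeland_score A I a (p'(i := q)) = copeland_score A I b (p'(i := q))"
      "copeland_score A I c (p'(i := q)) < copeland_score A I a (p'(i := q))"
      by (auto simp: winners_iff)
    \<comment> \<open>If \<open>a\<close> and \<open>b\<close> did not tie, their equal scores would
      force a majority cycle with all scores 0, and \<open>c\<close> would win too. Given the tie,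
      they fare equally against \<open>c\<close>, and both must beat it.\<close>
    then have sgns: "margin I (p'(i := q)) a b = 0" "margin I (p'(i := q)) a c > 0"
      "margin I (p'(i := q)) b c > 0"
      unfolding score by (auto simp: sgn_if split: if_splits)
    have "even (margin I (p'(i := q)) b c)"
      using even_margin_iff[OF fin profiles_fun_upd[OF i p' lin(1)], of b c] ev A d by auto
    with sgns(3) have "margin I (p'(i := q)) b c \<ge> 2"
      by presburger
    then have "margin I (p'(i := q')) a b = 0" "margin I (p'(i := q')) a c > 0"
      "margin I (p'(i := q')) b c \<ge> 0"
      using sgns votes by (simp_all add: upd)
    then have "copeland_score A I a (p'(i := q')) = 1" "copeland_score A I c (p'(i := q')) < 0"
      "copeland_score A I b (p'(i := q')) \<in> {0, 1}"
      unfolding score by (auto simp: sgn_if)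
    then have "copeland A I (p'(i := q')) = {a} \<or> copeland A I (p'(i := q')) = {a, b}"
      by (cases "copeland_score A I b (p'(i := q')) = 1") (auto simp: winners_iff)
    then show "weakly_pref (kelly A q) (copeland A I (p'(i := q'))) (copeland A I (p'(i := q)))"
      unfolding X' weakly_pref_def using kelly by auto
  qed
qed

section \<open>Four or more alternatives\<close>

text \<open>The sign of the only affected duel grows by some \<delta> \<ge> 0. Hence the score of
  \<open>x\<close> rises by \<delta>, that of \<open>s\<close> falls by \<delta>, and all others
  stay. As \<open>x\<close> was maximal before, any positive \<delta> leaves it the only
  winner.\<close>

lemma copeland_adjacent_swap:
  assumes fin: "finite A" "finite I" and i: "i \<in> I"
    and sx: "s \<in> A" "x \<in> A" "s \<noteq> x"
    and vote: "vote q s x = 1" "vote q' s x = - 1"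
    and same: "\<And>u v. u \<in> A \<Longrightarrow> v \<in> A \<Longrightarrow> {u, v} \<noteq> {s, x} \<Longrightarrow> vote q' u v = vote q u v"
    and x: "x \<in> copeland A I (p(i := q))"
  shows "copeland A I (p(i := q')) =
    (if sgn (margin I (p(i := q')) x s) = sgn (margin I (p(i := q)) x s)
     then copeland A I (p(i := q)) else {x})"
proof -
  let ?c = "\<lambda>u. copeland_score A I u (p(i := q))"
  let ?c' = "\<lambda>u. copeland_score A I u (p(i := q'))"
  let ?m = "margin I (p(i := q))" and ?m' = "margin I (p(i := q'))"
  note upd = margin_fun_upd[OF fin(2) i]
  have same_margin: "?m' u v = ?m u v" if "u \<in> A" "v \<in> A" "{u, v} \<noteq> {s, x}" for u v
    using same[OF that] by (simp add: upd)
  define \<delta> where "\<delta> = sgn (?m' x s) - sgn (?m x s)"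
  have "?m' x s = ?m x s + 2"
    using vote vote_swap[of q x s] vote_swap[of q' x s] by (simp add: upd)
  then have "\<delta> \<ge> 0"
    by (auto simp: \<delta>_def sgn_if)
  have other: "?c' u = ?c u" if "u \<in> A" "u \<noteq> s" "u \<noteq> x" for u
    unfolding copeland_score_margin[OF fin] using that
    by (intro sum.cong) (auto simp: same_margin doubleton_eq_iff)
  have cx: "?c' x = ?c x + \<delta>"
  proof -
    have "(\<Sum>v\<in>A - {s}. sgn (?m' x v)) = (\<Sum>v\<in>A - {s}. sgn (?m x v))"
      using sx by (intro sum.cong) (auto simp: same_margin doubleton_eq_iff)
    then show ?thesis
      unfolding copeland_score_margin[OF fin] \<delta>_def
      using fin sx by (simp add: sum.remove[of A s])
  qed
  have cs: "?c' s = ?c s - \<delta>"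
  proof -
    have "(\<Sum>v\<in>A - {x}. sgn (?m' s v)) = (\<Sum>v\<in>A - {x}. sgn (?m s v))"
      using sx by (intro sum.cong) (auto simp: same_margin doubleton_eq_iff)
    then show ?thesis
      unfolding copeland_score_margin[OF fin] \<delta>_def
      using fin sx margin_swap[of I "p(i := q)" s x] margin_swap[of I "p(i := q')" s x]
      by (simp add: sum.remove[of A x] sgn_minus)
  qed
  have max: "?c u \<le> ?c x" if "u \<in> A" for u
    using x that by (auto simp: in_copeland_iff)
  show ?thesis
  proof (cases "\<delta> = 0")
    case True
    then have "?c' u = ?c u" if "u \<in> A" for u
      using that other cx cs by (cases "u = s"; cases "u = x") auto
    then have "copeland A I (p(i := q')) = copeland A I (p(i := q))"
      by (auto simp: in_copeland_iff)
    with True show ?thesis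
      by (simp add: \<delta>_def)
  next
    case False
    with \<open>\<delta> \<ge> 0\<close> have "\<delta> > 0" by simp
    then have "?c' u < ?c' x" if "u \<in> A" "u \<noteq> x" for u
      using that other[of u] cx cs max[of u] by (cases "u = s") auto
    then have "copeland A I (p(i := q')) = {x}"
      using sx by (force simp: in_copeland_iff)
    with False show ?thesis
      by (simp add: \<delta>_def)
  qed
qed

text \<open>The sign change at \<open>p\<close> provides the strict gain. At the other profiles with
  these winners the swap yields the same set or the singleton of \<open>x\<close>, which is weakly
  better because \<open>x\<close> is the favourite winner.\<close>

theorem copeland_manipulable_by_adjacent_swap:
  assumes fin: "finite A" "finite I" and i: "i \<in> I"
    and lin: "q \<in> linear_orders A" "q' \<in> linear_orders A"
    and p: "p \<in> profiles A (I - {i})"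
    and sx: "s \<in> A" "x \<in> A" "s \<noteq> x"
    and vote: "vote q s x = 1" "vote q' s x = - 1"
    and same: "\<And>u v. u \<in> A \<Longrightarrow> v \<in> A \<Longrightarrow> {u, v} \<noteq> {s, x} \<Longrightarrow> vote q' u v = vote q u v"
    and sgn: "sgn (margin I (p(i := q')) x s) \<noteq> sgn (margin I (p(i := q)) x s)"
    and X: "x \<in> copeland A I (p(i := q))" "y \<in> copeland A I (p(i := q))" "y \<noteq> x"
    and top: "\<And>u. u \<in> copeland A I (p(i := q)) \<Longrightarrow> (x, u) \<in> q"
  shows "winner_info_manipulable A I (kelly A) (copeland A I)"
proof (rule winner_info_manipulableI[OF i lin p])
  have ne: "A \<noteq> {}"
    using sx by auto
  note swap = copeland_adjacent_swap[OF fin i sx vote same]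
  let ?X = "copeland A I (p(i := q))"
  have Xne: "?X \<in> nonempty_subsets A"
    using copeland_nonempty_subset[OF fin(1) ne profiles_fun_upd[OF i p lin(1)]] .
  have single: "({x}, ?X) \<in> kelly A q"
    using top Xne sx by (auto simp: kelly_def weakly_pref_def nonempty_subsets_def)
  show "weakly_pref (kelly A q) (copeland A I (p'(i := q'))) (copeland A I (p'(i := q)))"
    if "p' \<in> profiles A (I - {i})" "copeland A I (p'(i := q)) = ?X" for p'
    using swap[of p'] X(1) Xne single that
    by (auto simp: weakly_pref_def kelly_def split: if_splits)
  have "(y, x) \<notin> q"
    using top[OF X(2)] X(3) lin(1) linear_order_on_antisym[of A q x y]
    by (auto simp: linear_orders_def)
  then have "(?X, {x}) \<notin> kelly A q"
    using X by (auto simp: kelly_def weakly_pref_def)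
  then show "strictly_pref (kelly A q) (copeland A I (p(i := q'))) ?X"
    using swap[of p] X(1) sgn single by (auto simp: strictly_pref_def)
qed

text \<open>
  A list \<open>\<pi>\<close> gives the new positions of the first four alternatives of an enumeration \<open>h\<close>; all
  others keep their places at the bottom.
\<close>

definition position :: "nat list \<Rightarrow> nat \<Rightarrow> nat" where
  "position \<pi> k = (if k < 4 then \<pi> ! k else k)"

definition permuted_order :: "'a set \<Rightarrow> ('a \<Rightarrow> nat) \<Rightarrow> nat list \<Rightarrow> 'a rel" where
  "permuted_order A h \<pi> = rank_order A (\<lambda>x. position \<pi> (h x))"

text \<open>Majority margins computed on indices alone, so that concrete lists of positions can be
  evaluated by simplification whatever \<open>A\<close> is.\<close>

definition position_margin :: "nat list list \<Rightarrow> nat \<Rightarrow> nat \<Rightarrow> int" where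
  "position_margin \<pi>s j k = (\<Sum>\<pi>\<leftarrow>\<pi>s. sgn (int (position \<pi> k) - int (position \<pi> j)))"

lemma position_id: "position [0, 1, 2, 3] k = k"
  by (auto simp: position_def numeral_eq_Suc less_Suc_eq)

lemma position_swap: "position [1, 0, 2, 3] k = (if k = 0 then 1 else if k = 1 then 0 else k)"
  by (auto simp: position_def numeral_eq_Suc less_Suc_eq)

lemma sum_up_to_four: "(\<Sum>k = 0..<4::nat. f k) = f 0 + f 1 + f 2 + (f 3 :: int)"
  by (simp add: numeral_eq_Suc)

lemma position_less_four_iff: "set \<pi> = {..<4} \<Longrightarrow> length \<pi> = 4 \<Longrightarrow> position \<pi> k < 4 \<longleftrightarrow> k < 4"
  using nth_mem[of k \<pi>] by (auto simp: position_def)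

lemma permuted_order_linear:
  assumes "inj_on h A" "length \<pi> = 4" "set \<pi> = {..<4}"
  shows "permuted_order A h \<pi> \<in> linear_orders A"
  unfolding permuted_order_def
proof (intro rank_order_linear inj_onI)
  fix x y
  assume xy: "x \<in> A" "y \<in> A" and eq: "position \<pi> (h x) = position \<pi> (h y)"
  have "distinct \<pi>"
    using assms by (simp add: card_distinct)
  then have "h x = h y"
    using eq assms position_less_four_iff[of \<pi> "h x"] position_less_four_iff[of \<pi> "h y"]
      nth_eq_iff_index_eq[of \<pi> "h x" "h y"] by (auto simp: position_def split: if_splits)
  then show "x = y"
    using assms xy by (auto dest: inj_onD)
qed

lemma vote_permuted_order:
  assumes "x \<in> A" "y \<in> A"
  shows "vote (permuted_order A h \<pi>) x y =
    sgn (int (position \<pi> (h y)) - int (position \<pi> (h x)))"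
  unfolding permuted_order_def using assms by (rule vote_rank_order)

lemma position_margin_bottom:
  assumes "\<pi>s \<noteq> []" "\<And>\<pi>. \<pi> \<in> set \<pi>s \<Longrightarrow> length \<pi> = 4 \<and> set \<pi> = {..<4}" "j < 4" "k \<ge> 4"
  shows "position_margin \<pi>s j k > 0"
proof -
  have "sgn (int (position \<pi> k) - int (position \<pi> j)) = 1" if "\<pi> \<in> set \<pi>s" for \<pi>
  proof -
    have "position \<pi> j < 4" "\<not> position \<pi> k < 4"
      using assms(2)[OF that] assms(3,4) by (simp_all add: position_less_four_iff)
    then show ?thesis by simp
  qed
  then have "position_margin \<pi>s j k = (\<Sum>\<pi>\<leftarrow>\<pi>s. 1)"
    unfolding position_margin_def by (metis (no_types, lifting) map_eq_conv)
  then show ?thesis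
    using assms(1) by (simp add: sum_list_triv)
qed

text \<open>The sum is split at index 4. A top alternative beats all of the
  \<open>card A - 4\<close> others; a lower one loses four duels and gains at most 1 from each
  remaining index.\<close>

lemma copeland_score_top_four:
  assumes fin: "finite A" "finite I" and card: "card A \<ge> 4"
    and h: "bij_betw h A {0..<card A}"
    and m: "\<And>u v. u \<in> A \<Longrightarrow> v \<in> A \<Longrightarrow> margin I p u v = w (h u) (h v)"
    and w: "\<And>j k. j < 4 \<Longrightarrow> k \<ge> 4 \<Longrightarrow> w j k > 0"
    and u: "u \<in> A"
  shows "h u < 4 \<Longrightarrow>
      copeland_score A I u p = (\<Sum>k = 0..<4. sgn (w (h u) k)) + (int (card A) - 4)"
    and "h u \<ge> 4 \<Longrightarrow> copeland_score A I u p \<le> int (card A) - 8"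
proof -
  have "copeland_score A I u p = (\<Sum>v\<in>A. sgn (w (h u) (h v)))"
    unfolding copeland_score_margin[OF fin] using m u by (intro sum.cong) auto
  also have "\<dots> = (\<Sum>k = 0..<card A. sgn (w (h u) k))"
    by (rule sum.reindex_bij_betw[OF h])
  also have "\<dots> = (\<Sum>k = 0..<4. sgn (w (h u) k)) + (\<Sum>k = 4..<card A. sgn (w (h u) k))"
    using card by (simp add: sum.atLeastLessThan_concat)
  finally have eq: "copeland_score A I u p =
      (\<Sum>k = 0..<4. sgn (w (h u) k)) + (\<Sum>k = 4..<card A. sgn (w (h u) k))" .
  have n: "(\<Sum>k = 4..<card A. 1 :: int) = int (card A) - 4"
    using card by simp
  show "copeland_score A I u p = (\<Sum>k = 0..<4. sgn (w (h u) k)) + (int (card A) - 4)"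
    if "h u < 4"
    unfolding eq n[symmetric] using w[OF that] by (auto intro!: sum.cong)
  show "copeland_score A I u p \<le> int (card A) - 8" if "h u \<ge> 4"
  proof -
    have "sgn (w (h u) k) = - 1" if "k < 4" for k
    proof -
      have "k \<in> h ` A"
        using bij_betw_imp_surj_on[OF h] card that by auto
      then obtain v where "v \<in> A" "h v = k"
        by auto
      then have "w (h u) k = - w k (h u)"
        using m[of u v] m[of v u] u margin_swap[of I p u v] by simp
      then show ?thesis
        using w[of k "h u"] that \<open>h u \<ge> 4\<close> by simp
    qed
    then have "(\<Sum>k = 0..<4. sgn (w (h u) k)) = (\<Sum>k = 0..<4::nat. - 1)"
      by (intro sum.cong) auto
    moreover have "(\<Sum>k = 4..<card A. sgn (w (h u) k)) \<le> (\<Sum>k = 4..<card A. 1)"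
      by (intro sum_mono) (auto simp: sgn_if)
    ultimately show ?thesis
      unfolding eq using n by simp
  qed
qed

text \<open>This leaves a numerical check on the indices 0 to 3, which stand for \<open>s\<close>,
  \<open>x\<close>, \<open>y\<close>, \<open>t\<close>. Here \<open>tie\<close> makes
  \<open>y\<close> a winner beside \<open>x\<close>, \<open>less\<close> excludes \<open>s\<close>,
  \<open>le\<close> keeps \<open>t\<close> from overtaking, \<open>pos\<close> excludes the lower
  alternatives, and \<open>flip\<close> makes the swap matter.\<close>

lemma four_or_more_manipulable:
  fixes \<pi>s :: "nat list list"
  defines "w \<equiv> position_margin ([0, 1, 2, 3] # \<pi>s)"
    and "w' \<equiv> position_margin ([1, 0, 2, 3] # \<pi>s)"
  assumes fin: "finite A" "finite I" and card: "card A \<ge> 4" and "I \<noteq> {}"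
    and perm: "\<And>\<pi>. \<pi> \<in> set \<pi>s \<Longrightarrow> length \<pi> = 4 \<and> set \<pi> = {..<4}"
    and len: "length \<pi>s < card I" "even (card I - 1 - length \<pi>s)"
    and flip: "sgn (w' 1 0) \<noteq> sgn (w 1 0)"
    and tie: "(\<Sum>k = 0..<4. sgn (w 2 k)) = (\<Sum>k = 0..<4. sgn (w 1 k))"
    and less: "(\<Sum>k = 0..<4. sgn (w 0 k)) < (\<Sum>k = 0..<4. sgn (w 1 k))"
    and le: "(\<Sum>k = 0..<4. sgn (w 3 k)) \<le> (\<Sum>k = 0..<4. sgn (w 1 k))"
    and pos: "0 \<le> (\<Sum>k = 0..<4. sgn (w 1 k))"
  shows "winner_info_manipulable A I (kelly A) (copeland A I)"
proof -
  obtain i where i: "i \<in> I"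
    using assms by auto
  obtain h where h: "bij_betw h A {0..<card A}"
    using ex_bij_betw_finite_nat[OF fin(1)] by auto
  have inj: "inj_on h A"
    using h by (rule bij_betw_imp_inj_on)
  have "{0, 1, 2, 3} \<subseteq> h ` A"
    using bij_betw_imp_surj_on[OF h] card by auto
  then obtain s x y where s: "s \<in> A" "h s = 0" and x: "x \<in> A" "h x = 1" and y: "y \<in> A" "h y = 2"
    by auto
  define q where "q = permuted_order A h [0, 1, 2, 3]"
  define q' where "q' = permuted_order A h [1, 0, 2, 3]"
  have four: "set [0, 1, 2, 3] = {..<4 :: nat}" "set [1, 0, 2, 3] = {..<4 :: nat}"
    by auto
  have lin: "q \<in> linear_orders A" "q' \<in> linear_orders A"
    "set (map (permuted_order A h) \<pi>s) \<subseteq> linear_orders A"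
    unfolding q_def q'_def
    using permuted_order_linear[OF inj _ four(1)] permuted_order_linear[OF inj _ four(2)]
      permuted_order_linear[OF inj] perm by (simp_all add: image_subset_iff)
  have "card (I - {i}) = card I - 1"
    using i by (simp add: card_Diff_singleton)
  then have len': "length (map (permuted_order A h) \<pi>s) \<le> card (I - {i})"
    "even (card (I - {i}) - length (map (permuted_order A h) \<pi>s))"
    using len by auto
  have "finite (I - {i})" "linear_orders A \<noteq> {}"
    using fin lin by auto
  from ex_profile_margin[OF this(1) lin(3) this(2) len'] obtain p where p: "p \<in> profiles A (I - {i})"
    and m: "\<And>u v. margin (I - {i}) p u v = (\<Sum>r\<leftarrow>map (permuted_order A h) \<pi>s. vote r u v)"
    by blast
  have margin: "margin I (p(i := permuted_order A h \<pi>)) u v = position_margin (\<pi> # \<pi>s) (h u) (h v)"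
    if "u \<in> A" "v \<in> A" for u v \<pi>
    using that by (simp add: margin_fun_upd[OF fin(2) i] m vote_permuted_order position_margin_def o_def)
  have margin_w: "margin I (p(i := q)) u v = w (h u) (h v)" if "u \<in> A" "v \<in> A" for u v
    unfolding q_def w_def using margin that .
  have perm': "length \<pi> = 4 \<and> set \<pi> = {..<4}" if "\<pi> \<in> set ([0, 1, 2, 3] # \<pi>s)" for \<pi>
    using that perm four(1) by (cases "\<pi> \<in> set \<pi>s") simp_all
  have bottom: "w j k > 0" if "j < 4" "k \<ge> 4" for j k
    unfolding w_def by (rule position_margin_bottom[OF _ perm' that]) simp
  have score: "h u < 4 \<Longrightarrow>
      copeland_score A I u (p(i := q)) = (\<Sum>k = 0..<4. sgn (w (h u) k)) + (int (card A) - 4)"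
    "h u \<ge> 4 \<Longrightarrow> copeland_score A I u (p(i := q)) \<le> int (card A) - 8" if "u \<in> A" for u
    using copeland_score_top_four[OF fin card h margin_w bottom that] by blast+
  have scores: "copeland_score A I u (p(i := q)) \<le> copeland_score A I x (p(i := q))"
    "u = s \<Longrightarrow> copeland_score A I u (p(i := q)) < copeland_score A I x (p(i := q))" if "u \<in> A" for u
  proof -
    have "h u = 0 \<or> h u = 1 \<or> h u = 2 \<or> h u = 3 \<or> h u \<ge> 4"
      by linarith
    then show "copeland_score A I u (p(i := q)) \<le> copeland_score A I x (p(i := q))"
      using score[OF that] score(1)[OF x(1)] x(2) tie less le pos by auto
    show "copeland_score A I u (p(i := q)) < copeland_score A I x (p(i := q))" if "u = s"
      using that score(1)[OF s(1)] score(1)[OF x(1)] s(2) x(2) less by simp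
  qed
  show ?thesis
  proof (rule copeland_manipulable_by_adjacent_swap[OF fin i lin(1,2) p s(1) x(1), of y])
    show "s \<noteq> x" "y \<noteq> x"
      using s x y by auto
    show "vote q s x = 1" "vote q' s x = - 1"
      using s x by (simp_all add: q_def q'_def vote_permuted_order position_def)
    show "sgn (margin I (p(i := q')) x s) \<noteq> sgn (margin I (p(i := q)) x s)"
      using flip s x by (simp add: q_def q'_def margin w_def w'_def)
    show "x \<in> copeland A I (p(i := q))"
      using x scores by (simp add: in_copeland_iff)
    have "copeland_score A I y (p(i := q)) = copeland_score A I x (p(i := q))"
      using score(1)[OF y(1)] score(1)[OF x(1)] x(2) y(2) tie by simp
    then show "y \<in> copeland A I (p(i := q))"
      using y scores by (simp add: in_copeland_iff)
    show "(x, u) \<in> q" if "u \<in> copeland A I (p(i := q))" for u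
    proof -
      \<comment> \<open>Only \<open>s\<close> stands above \<open>x\<close> in the true order, and
        \<open>s\<close> is not a winner.\<close>
      have "u \<in> A" "u \<noteq> s"
        using that x(1) scores(2)[of s] s(1) by (auto simp: in_copeland_iff)
      then have "h u \<noteq> 0"
        using inj s by (metis inj_onD)
      then have "h u = 1 \<or> h u = 2 \<or> h u = 3 \<or> h u \<ge> 4"
        by linarith
      then show ?thesis
        using x \<open>u \<in> A\<close>
          by (auto simp: q_def permuted_order_def rank_order_def position_id simp del: One_nat_def)
    qed
    show "vote q' u v = vote q u v" if uv: "u \<in> A" "v \<in> A" "{u, v} \<noteq> {s, x}" for u v
    proof -
      have "{h u, h v} \<noteq> {0, 1}"
        using uv s x inj by (metis doubleton_eq_iff inj_onD)
      then show ?thesis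
        using uv by (auto simp: q_def q'_def vote_permuted_order position_id position_swap
            doubleton_eq_iff simp del: One_nat_def)
    qed
  qed
qed

text \<open>
  Let \<open>s, x, y, t\<close> be the first four alternatives. The manipulator has the true order \<open>s, x, y, t\<close>
  and reports \<open>x, s, y, t\<close>. If the number of voters is even, one other voter has \<open>y, x, t, s\<close>; if
  it is odd, two others have \<open>x, y, t, s\<close> and \<open>y, t, s, x\<close>. In both cases the winners under the
  true order are \<open>x\<close> and \<open>y\<close>.
\<close>

theorem copeland_four_or_more_manipulable:
  assumes fin: "finite A" "finite I" and "card A \<ge> 4" "card I \<ge> 2"
  shows "winner_info_manipulable A I (kelly A) (copeland A I)"
proof -
  have "I \<noteq> {}"
    using assms by auto
  note rule = four_or_more_manipulable[OF fin assms(3) this]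
  note margin_simps = position_margin_def position_def sum_up_to_four
  show ?thesis
  proof (cases "even (card I)")
    case True
    \<comment> \<open>The swap turns a tie of \<open>x\<close> with \<open>s\<close> into a win.
      Among the four, the true scores of \<open>s\<close>, \<open>x\<close>, \<open>y\<close>,
      \<open>t\<close> are 0, 1, 1, -2.\<close>
    show ?thesis
      by (rule rule[of "[[3, 1, 0, 2]]"])
        (use assms(4) True in \<open>auto simp: margin_simps\<close>)
  next
    case False
    with assms(4) have "card I \<ge> 3"
      by presburger
    \<comment> \<open>Here \<open>x\<close> loses to \<open>s\<close> by one vote and the swap
      reverses this. Among the four, the true scores are -1, 1, 1, -1.\<close>
    then show ?thesis
      by (intro rule[of "[[3, 0, 1, 2], [2, 3, 0, 1]]"])
        (use False in \<open>auto simp: margin_simps\<close>)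
  qed
qed

theorem theorem19:
  fixes A :: "'a set" and I :: "'i set"
  assumes "finite A" and "card A \<ge> 2"
    and "finite I" and "card I \<ge> 2"
  shows "(card A = 3 \<and> odd (card I) \<longrightarrow> strategy_proof A I (kelly A) (copeland A I)) \<and>
    (card A = 3 \<and> even (card I) \<longrightarrow> winner_info_manipulable A I (kelly A) (copeland A I)) \<and>
    (card A \<ge> 4 \<longrightarrow> winner_info_manipulable A I (kelly A) (copeland A I))"
  using assms copeland_three_odd_strategy_proof copeland_three_even_manipulable
    copeland_four_or_more_manipulable by blast

end
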